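(* Let $X$ be a Hausdorff space and let $\{\omega^{D_\lambda}_\cdot\}$ be a Radon harmonic measure system on $X$. Suppose $D\in\{D_\lambda\}$ and $\partial D$ is compact. If the Radon–Nikodym derivative $\frac{\mathrm{d}\omega^D_x}{\mathrm{d}\omega^D_y}(z)$ is continuous with respect to $x,y\in D$ and $z\in\partial D$, then $H(A;D)<+\infty$ for any subset $A\subset\subset D$ (i.e. $\overline A$ is compact and contained in $D$).
   Context: Measures: a measure on a set $Y$ is a map $\omega:2^Y\to[0,\infty]$ with $\omega(\emptyset)=0$ and countable subadditivity (an outer measure); measurability is in the sense of Carathéodory; it is Borel if every Borel set is measurable. It is Radon if it is Borel regular (Borel, and every set is contained in a Borel set of the same measure) and finite on compact sets. $\nu\ll\mu$ means $\mu(A)=0\Rightarrow\nu(A)=0$ for all $A\subseteq Y$. Write $\omega(f)=\int f\,\mathrm d\omega$. Pre-harmonic measure: let $D\subset X$ be open with $\partial D\neq\emptyset$. A family of Borel measures $\{\omega^D_x:2^{\partial D}\to[0,1]:x\in D\}$ on $\partial D$ is a pre-harmonic measure relative to $D$ if for every connected component $V$ of $D$: (1) $\omega_x^D(\partial V)=1$ for all $x\in V$; (2) $\omega^D_x\ll\omega^D_y$ for all $x,y\in V$. Harmonic measure: let $\mathcal F_x=\{E\Delta N: E\subseteq\partial D\text{ Borel},\ N\subseteq\partial D,\ \omega_x^D(N)=0\}$ and $\mathcal F=\bigcap_{x\in D}\mathcal F_x$. Functions measurable w.r.t. $\mathcal F$ are called $\omega_\cdot^D$-measurable. The pre-harmonic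 measure restricted to $\mathcal F$ is the harmonic measure $\omega_\cdot^D$ relative to $D$. $L(\partial D;\omega_\cdot^D)$ is the set of $\omega_\cdot^D$-measurable $f$ on $\partial D$ integrable with respect to $\omega_x^D$ for every $x\in D$. $\omega_\cdot^D$ is continuous if $x\mapsto\omega_x^D(f)$ is continuous on $D$ for every $f\in L(\partial D;\omega_\cdot^D)$. Convention: $\omega_y^D(f):=f(y)$ for $y\in\partial D$. Harmonic measure system: a family of continuous harmonic measures $\{\omega_\cdot^{D_\lambda}\}$ which is compatible: for any $D,\widetilde D\in\{D_\lambda\}$ with $D\cap\widetilde D\ne\emptyset$, any $f\in L(\partial D;\omega_\cdot^D)$ and $\widetilde f\in L(\partial\widetilde D;\omega_\cdot^{\widetilde D})$ such that $\omega_y^{\widetilde D}(\widetilde f)=f(y)$ for all $y\in\widetilde D\cap\partial D$ and $\omega_y^D(f)=\widetilde f(y)$ for all $y\in\partial\widetilde D\cap\overline D$, one has $\omega_x^D(f)=\omega_x^{\widetilde D}(\widetilde f)$ for all $x\in D\cap\widetilde D$. It is a Radon harmonic measure system if all the measures $\omega_x^{D_\lambda}$ are Radon. Harnack index: for $A\subseteq D\in\{D_\lambda\}$, $$H(A;D):=\sup\left\{\frac{\omega_x^D(f)}{\omega_y^D(f)}:\ x,y\in A,\ f\in L(\partial D;\omega_\cdot^D)\setminus\{0\},\ f\ge0\right\}\in[1,+\infty],$$ where functions agreeing off an $\omega_\cdot^D$-null set (null for all $\omega_x^D$, $x\in D$) are identified. *)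

theory Defs
  imports "HOL-Analysis.Analysis"
begin

section \<open>Measures in the sense of Caratheodory\<close>

text \<open>
  A measure on \<open>Y\<close> is a set function on all subsets of \<open>Y\<close>; its values on sets that are not
  contained in \<open>Y\<close> are irrelevant.  In \<^const>\<open>outer_measure_space\<close> subadditivity is only required
  for disjoint sequences, which together with monotonicity gives it for all sequences.
  The Borel subsets of the subspace \<open>Y\<close> are the sets of \<^term>\<open>restrict_space borel Y\<close>.
\<close>

definition borel_outer_measure :: "'a::topological_space set \<Rightarrow> ('a set \<Rightarrow> ennreal) \<Rightarrow> bool" where
  "borel_outer_measure Y \<mu> \<longleftrightarrow>
     outer_measure_space (Pow Y) \<mu> \<and>
     sets (restrict_space borel Y) \<subseteq> lambda_system Y (Pow Y) \<mu>"

definition radon_outer_measure :: "'a::topological_space set \<Rightarrow> ('a set \<Rightarrow> ennreal) \<Rightarrow> bool" where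
  "radon_outer_measure Y \<mu> \<longleftrightarrow>
     borel_outer_measure Y \<mu> \<and>
     (\<forall>A\<subseteq>Y. \<exists>B\<in>sets (restrict_space borel Y). A \<subseteq> B \<and> \<mu> B = \<mu> A) \<and>
     (\<forall>K\<subseteq>Y. compact K \<longrightarrow> \<mu> K < \<infinity>)"

definition outer_abs_cont :: "'a set \<Rightarrow> ('a set \<Rightarrow> ennreal) \<Rightarrow> ('a set \<Rightarrow> ennreal) \<Rightarrow> bool" where
  "outer_abs_cont Y \<nu> \<mu> \<longleftrightarrow> (\<forall>A\<subseteq>Y. \<mu> A = 0 \<longrightarrow> \<nu> A = 0)"


section \<open>Harmonic measures\<close>

text \<open>
  A family of measures relative to \<open>D\<close> is a function \<open>\<omega> :: 'a \<Rightarrow> 'a set \<Rightarrow> ennreal\<close>, of which only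
  the values \<open>\<omega> x A\<close> with \<open>x \<in> D\<close> and \<open>A \<subseteq> frontier D\<close> matter.  As \<open>\<omega> x\<close> lives on
  \<open>frontier D\<close>, the measure of \<open>frontier V\<close> is that of its trace on \<open>frontier D\<close>; if \<open>X\<close> is locally
  connected, then \<open>frontier V \<subseteq> frontier D\<close> for each component \<open>V\<close> of \<open>D\<close>.
\<close>

definition pre_harmonic_measure ::
  "'a::topological_space set \<Rightarrow> ('a \<Rightarrow> 'a set \<Rightarrow> ennreal) \<Rightarrow> bool" where
  "pre_harmonic_measure D \<omega> \<longleftrightarrow>
     open D \<and> frontier D \<noteq> {} \<and>
     (\<forall>x\<in>D. borel_outer_measure (frontier D) (\<omega> x) \<and> (\<forall>A\<subseteq>frontier D. \<omega> x A \<le> 1)) \<and>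
     (\<forall>V\<in>components D.
        (\<forall>x\<in>V. \<omega> x (frontier V \<inter> frontier D) = 1) \<and>
        (\<forall>x\<in>V. \<forall>y\<in>V. outer_abs_cont (frontier D) (\<omega> x) (\<omega> y)))"

definition harmonic_sets ::
  "'a::topological_space set \<Rightarrow> ('a \<Rightarrow> 'a set \<Rightarrow> ennreal) \<Rightarrow> 'a set set" where
  "harmonic_sets D \<omega> =
     {A. A \<subseteq> frontier D \<and>
         (\<forall>x\<in>D. \<exists>E N. E \<in> sets (restrict_space borel (frontier D)) \<and>
                      N \<subseteq> frontier D \<and> \<omega> x N = 0 \<and> A = sym_diff E N)}"

definition harmonic_measure ::
  "'a::topological_space set \<Rightarrow> ('a \<Rightarrow> 'a set \<Rightarrow> ennreal) \<Rightarrow> 'a \<Rightarrow> 'a measure" where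
  "harmonic_measure D \<omega> x = measure_of (frontier D) (harmonic_sets D \<omega>) (\<omega> x)"

text \<open>
  Elements of the function space are represented by functions on the whole type; their values
  off \<open>frontier D\<close> are irrelevant.
\<close>

definition harmonic_L ::
  "'a::topological_space set \<Rightarrow> ('a \<Rightarrow> 'a set \<Rightarrow> ennreal) \<Rightarrow> ('a \<Rightarrow> real) set" where
  "harmonic_L D \<omega> = {f. \<forall>x\<in>D. integrable (harmonic_measure D \<omega> x) f}"

definition harmonic_null ::
  "'a::topological_space set \<Rightarrow> ('a \<Rightarrow> 'a set \<Rightarrow> ennreal) \<Rightarrow> 'a set \<Rightarrow> bool" where
  "harmonic_null D \<omega> N \<longleftrightarrow> N \<subseteq> frontier D \<and> (\<forall>x\<in>D. \<omega> x N = 0)"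

text \<open>
  The value \<open>\<omega>\<^sub>x(f)\<close> for \<open>x \<in> closure D\<close>, with the convention \<open>\<omega>\<^sub>y(f) = f(y)\<close> for
  \<open>y \<in> frontier D\<close>.
\<close>

definition harmonic_eval ::
  "'a::topological_space set \<Rightarrow> ('a \<Rightarrow> 'a set \<Rightarrow> ennreal) \<Rightarrow> 'a \<Rightarrow> ('a \<Rightarrow> real) \<Rightarrow> real" where
  "harmonic_eval D \<omega> x f = (if x \<in> D then integral\<^sup>L (harmonic_measure D \<omega> x) f else f x)"

definition continuous_harmonic ::
  "'a::topological_space set \<Rightarrow> ('a \<Rightarrow> 'a set \<Rightarrow> ennreal) \<Rightarrow> bool" where
  "continuous_harmonic D \<omega> \<longleftrightarrow>
     (\<forall>f\<in>harmonic_L D \<omega>. continuous_on D (\<lambda>x. harmonic_eval D \<omega> x f))"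


section \<open>Harmonic measure systems\<close>

text \<open>
  A system is indexed by its domains: \<open>\<D>\<close> is the set of all \<open>D\<^sub>\<lambda>\<close>, and \<open>\<omega> D x\<close> is
  the measure at \<open>x\<close> relative to \<open>D\<close>.
\<close>

definition compatible_harmonic ::
  "'a::topological_space set set \<Rightarrow> ('a set \<Rightarrow> 'a \<Rightarrow> 'a set \<Rightarrow> ennreal) \<Rightarrow> bool" where
  "compatible_harmonic \<D> \<omega> \<longleftrightarrow>
     (\<forall>D\<in>\<D>. \<forall>D'\<in>\<D>. D \<inter> D' \<noteq> {} \<longrightarrow>
        (\<forall>f\<in>harmonic_L D (\<omega> D). \<forall>f'\<in>harmonic_L D' (\<omega> D').
           (\<forall>y\<in>D' \<inter> frontier D. harmonic_eval D' (\<omega> D') y f' = f y) \<and>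
           (\<forall>y\<in>frontier D' \<inter> closure D. harmonic_eval D (\<omega> D) y f = f' y) \<longrightarrow>
           (\<forall>x\<in>D \<inter> D'. harmonic_eval D (\<omega> D) x f = harmonic_eval D' (\<omega> D') x f')))"

definition harmonic_measure_system ::
  "'a::topological_space set set \<Rightarrow> ('a set \<Rightarrow> 'a \<Rightarrow> 'a set \<Rightarrow> ennreal) \<Rightarrow> bool" where
  "harmonic_measure_system \<D> \<omega> \<longleftrightarrow>
     (\<forall>D\<in>\<D>. pre_harmonic_measure D (\<omega> D) \<and> continuous_harmonic D (\<omega> D)) \<and>
     compatible_harmonic \<D> \<omega>"

definition radon_harmonic_measure_system ::
  "'a::topological_space set set \<Rightarrow> ('a set \<Rightarrow> 'a \<Rightarrow> 'a set \<Rightarrow> ennreal) \<Rightarrow> bool" where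
  "radon_harmonic_measure_system \<D> \<omega> \<longleftrightarrow>
     harmonic_measure_system \<D> \<omega> \<and>
     (\<forall>D\<in>\<D>. \<forall>x\<in>D. radon_outer_measure (frontier D) (\<omega> D x))"


section \<open>Harnack index\<close>

text \<open>
  Classes of functions modulo null sets are handled through representatives: a class is
  nonnegative iff it has a representative that is nonnegative on \<open>frontier D\<close>, and it is nonzero
  iff its representatives do not vanish off any null set.  In \<^typ>\<open>ennreal\<close> one has \<open>0 / 0 = 0\<close>
  and \<open>a / 0 = \<infinity>\<close> for \<open>a > 0\<close>, so a quotient \<open>0 / 0\<close> (possible if \<open>D\<close> is disconnected) does not
  contribute to the supremum.
\<close>

definition harnack_index ::
  "'a::topological_space set \<Rightarrow> ('a \<Rightarrow> 'a set \<Rightarrow> ennreal) \<Rightarrow> 'a set \<Rightarrow> ennreal" where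
  "harnack_index D \<omega> A =
     Sup {ennreal (harmonic_eval D \<omega> x f) / ennreal (harmonic_eval D \<omega> y f) | x y f.
            x \<in> A \<and> y \<in> A \<and> f \<in> harmonic_L D \<omega> \<and>
            (\<forall>z\<in>frontier D. 0 \<le> f z) \<and>
            \<not> (\<exists>N. harmonic_null D \<omega> N \<and> (\<forall>z\<in>frontier D - N. f z = 0))}"


section \<open>Continuous Radon--Nikodym derivatives\<close>

text \<open>
  The derivative is determined only up to null sets, and \<^const>\<open>RN_deriv\<close> is an arbitrary choice of
  a version (and \<open>0\<close> if there is none), so continuity is expressed for some version.  The
  existence of the derivative for all \<open>x, y \<in> D\<close> is part of the condition.
\<close>

definition is_RN_derivative :: "'a measure \<Rightarrow> 'a measure \<Rightarrow> ('a \<Rightarrow> ennreal) \<Rightarrow> bool" where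
  "is_RN_derivative M N g \<longleftrightarrow> g \<in> borel_measurable M \<and> density M g = N"

definition continuous_RN_derivative ::
  "'a::topological_space set \<Rightarrow> ('a \<Rightarrow> 'a set \<Rightarrow> ennreal) \<Rightarrow> bool" where
  "continuous_RN_derivative D \<omega> \<longleftrightarrow>
     (\<exists>k :: 'a \<Rightarrow> 'a \<Rightarrow> 'a \<Rightarrow> real.
        continuous_on (D \<times> D \<times> frontier D) (\<lambda>(x, y, z). k x y z) \<and>
        (\<forall>x\<in>D. \<forall>y\<in>D.
           (\<forall>z\<in>frontier D. 0 \<le> k x y z) \<and>
           is_RN_derivative (harmonic_measure D \<omega> y) (harmonic_measure D \<omega> x)
             (\<lambda>z. ennreal (k x y z))))"

end

theory Submission
  imports Defs
begin

text \<open>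
  Since \<open>\<omega>\<^sub>x(f) = \<omega>\<^sub>y(f \<cdot> d\<omega>\<^sub>x/d\<omega>\<^sub>y)\<close>, any upper bound for the Radon--Nikodym derivative on
  \<open>closure A \<times> closure A \<times> frontier D\<close> bounds the Harnack index, and this product is compact.
\<close>

lemma space_harmonic_measure [simp]: "space (harmonic_measure D \<omega> x) = frontier D"
  unfolding harmonic_measure_def
  by (rule space_measure_of) (auto simp: harmonic_sets_def)

text \<open>The bound is asked to be nonnegative because it is later passed to
  \<open>ennreal\<close>, which truncates negative reals to 0.\<close>

lemma continuous_on_compact_imp_upper_bound:
  fixes g :: "'a::topological_space \<Rightarrow> real"
  assumes "compact S" and "continuous_on S g"
  obtains C where "0 \<le> C" and "\<And>p. p \<in> S \<Longrightarrow> g p \<le> C"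
proof -
  have "bounded (g ` S)"
    using assms by (intro compact_imp_bounded compact_continuous_image)
  then obtain b where b: "\<And>p. p \<in> S \<Longrightarrow> \<bar>g p\<bar> \<le> b"
    by (auto simp: bounded_iff)
  show ?thesis
    by (rule that[of "max 0 b"]) (use b in force)+
qed

text \<open>After the change of density the pointwise bound k f \<le> C f is integrated against
  \<open>M\<close>; it uses both f \<ge> 0 and k \<le> C.\<close>

lemma integral_le_RN_derivative_bound:
  fixes f k :: "'a \<Rightarrow> real"
  assumes RN: "is_RN_derivative M N (\<lambda>z. ennreal (k z))"
    and f: "integrable M f" "integrable N f"
    and f_nonneg: "\<And>z. z \<in> space M \<Longrightarrow> 0 \<le> f z"
    and k: "\<And>z. z \<in> space M \<Longrightarrow> 0 \<le> k z" "\<And>z. z \<in> space M \<Longrightarrow> k z \<le> C"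
  shows "integral\<^sup>L N f \<le> C * integral\<^sup>L M f"
proof -
  have N: "N = density M (\<lambda>z. ennreal (k z))"
    and [measurable]: "(\<lambda>z. ennreal (k z)) \<in> borel_measurable M"
    using RN by (auto simp: is_RN_derivative_def)
  \<comment> \<open>Only the extended-valued density is known to be measurable. Since k \<ge> 0 on
    the space, \<open>enn2real\<close> recovers \<open>k\<close> from it there.\<close>
  have "(\<lambda>z. enn2real (ennreal (k z))) \<in> borel_measurable M"
    by measurable
  then have [measurable]: "k \<in> borel_measurable M"
    by (subst measurable_cong[of M k "\<lambda>z. enn2real (ennreal (k z))"]) (simp_all add: k)
  have [measurable]: "f \<in> borel_measurable M"
    using f by auto
  have AE: "AE z in M. 0 \<le> k z"
    using k by auto
  have "integral\<^sup>L N f = (\<integral>z. k z * f z \<partial>M)"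
    unfolding N by (subst integral_density) (use AE in auto)
  also have "\<dots> \<le> (\<integral>z. C * f z \<partial>M)"
  proof (rule integral_mono)
    \<comment> \<open>A Bochner integral is 0 by default for a nonintegrable function, so
      monotonicity needs integrability of both sides. For the product it is integrability of
      \<open>f\<close> under \<open>N\<close>, read through the density.\<close>
    show "integrable M (\<lambda>z. k z * f z)"
      using f(2) AE unfolding N by (subst (asm) integrable_density) auto
  qed (use f f_nonneg k in \<open>auto intro: mult_right_mono\<close>)
  finally show ?thesis
    by simp
qed

lemma ennreal_divide_le:
  assumes "a \<le> C * b" and "0 \<le> b" and "0 \<le> C"
  shows "ennreal a / ennreal b \<le> ennreal C"
proof (cases "b = 0")
  \<comment> \<open>Here the hypothesis forces a \<le> 0, so the quotient is 0 / 0, which is 0 in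
    \<open>ennreal\<close>.\<close>
  case True
  then show ?thesis
    using assms by (simp add: ennreal_neg)
next
  case False
  then have "0 < ennreal b"
    using assms by (simp add: ennreal_zero_less_mult_iff)
  moreover have "ennreal a \<le> ennreal b * ennreal C"
    using assms by (simp add: ennreal_mult[symmetric] mult.commute ennreal_leI)
  ultimately show ?thesis
    by (rule divide_le_posI_ennreal)
qed

theorem corollary2p1:
  fixes \<D> :: "'a::t2_space set set"
    and \<omega> :: "'a set \<Rightarrow> 'a \<Rightarrow> 'a set \<Rightarrow> ennreal"
    and D A :: "'a set"
  assumes "radon_harmonic_measure_system \<D> \<omega>"
    and "D \<in> \<D>"
    and "compact (frontier D)"
    and "continuous_RN_derivative D (\<omega> D)"
    and "compact (closure A)" and "closure A \<subseteq> D"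
  shows "harnack_index D (\<omega> D) A < \<infinity>"
proof -
  obtain k :: "'a \<Rightarrow> 'a \<Rightarrow> 'a \<Rightarrow> real" where
    cont: "continuous_on (D \<times> D \<times> frontier D) (\<lambda>(x, y, z). k x y z)" and
    k_nonneg: "\<And>x y z. x \<in> D \<Longrightarrow> y \<in> D \<Longrightarrow> z \<in> frontier D \<Longrightarrow> 0 \<le> k x y z" and
    RN: "\<And>x y. x \<in> D \<Longrightarrow> y \<in> D \<Longrightarrow>
      is_RN_derivative (harmonic_measure D (\<omega> D) y) (harmonic_measure D (\<omega> D) x)
        (\<lambda>z. ennreal (k x y z))"
    using assms(4) unfolding continuous_RN_derivative_def by metis
  have "compact (closure A \<times> closure A \<times> frontier D)"
    using assms by (intro compact_Times)
  moreover have "continuous_on (closure A \<times> closure A \<times> frontier D) (\<lambda>(x, y, z). k x y z)"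
    using cont by (rule continuous_on_subset) (use assms in auto)
  \<comment> \<open>\<open>C\<close> is fixed before the points and the function, so it bounds all
    the quotients in the supremum at once.\<close>
  ultimately obtain C where C: "0 \<le> C"
    "\<And>p. p \<in> closure A \<times> closure A \<times> frontier D \<Longrightarrow> (\<lambda>(x, y, z). k x y z) p \<le> C"
    using continuous_on_compact_imp_upper_bound by blast
  have "ennreal (harmonic_eval D (\<omega> D) x f) / ennreal (harmonic_eval D (\<omega> D) y f) \<le> ennreal C"
    if "x \<in> A" "y \<in> A" and f: "f \<in> harmonic_L D (\<omega> D)" and f_nonneg: "\<forall>z\<in>frontier D. 0 \<le> f z"
    for x y f
  proof -
    have closure: "x \<in> closure A" "y \<in> closure A"
      using that closure_subset by auto
    then have D: "x \<in> D" "y \<in> D"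
      using assms by auto
    have "integral\<^sup>L (harmonic_measure D (\<omega> D) x) f \<le> C * integral\<^sup>L (harmonic_measure D (\<omega> D) y) f"
    proof (rule integral_le_RN_derivative_bound[OF RN[OF D]])
      show "k x y z \<le> C" if "z \<in> space (harmonic_measure D (\<omega> D) y)" for z
        using C(2)[of "(x, y, z)"] closure that by simp
    qed (use f f_nonneg D k_nonneg in \<open>auto simp: harmonic_L_def\<close>)
    moreover have "0 \<le> integral\<^sup>L (harmonic_measure D (\<omega> D) y) f"
      using f_nonneg by (intro integral_nonneg_AE) auto
    \<comment> \<open>As both points lie in \<open>D\<close>, \<open>harmonic_eval\<close> takes its
      integral branch, not the boundary convention.\<close>
    ultimately show ?thesis
      using D C(1) by (simp add: harmonic_eval_def ennreal_divide_le)
  qed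
  then have "harnack_index D (\<omega> D) A \<le> ennreal C"
    unfolding harnack_index_def by (intro Sup_least) auto
  also have "\<dots> < \<infinity>"
    by simp
  finally show ?thesis .
qed

end
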